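(* If $G$ is a $d$-regular graph with order $n\geq 3$, then $$\mathrm{gp}(\mathcal{M}(G))\leq n+\left\lfloor \frac{d-1}{2}+\frac{1}{d}\right\rfloor .$$
   Context: All graphs are simple, connected and finite. A set $S$ of vertices of a graph $H$ is a general position set if no shortest path in $H$ contains three or more vertices of $S$; $\mathrm{gp}(H)$ is the number of vertices in a largest general position set of $H$. The Mycielskian $\mathcal{M}(G)$ of a graph $G$ with vertex set $V$ and edge set $E$ has vertex set $V\cup V'\cup\{u^*\}$, where $V'=\{u' : u\in V\}$ is a disjoint copy of $V$ and $u^*$ is an additional vertex (the root), and edge set $E\cup\{uv' : uv\in E\}\cup\{v'u^* : v'\in V'\}$ (for each edge $uv\in E$ both $uv'$ and $vu'$ are included). *)

theory Defs
  imports Complex_Main "Graph_Theory.Graph_Theory"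
begin

text \<open>
  A finite simple graph is a \<^locale>\<open>pair_graph\<close>: an edge \<open>uv\<close> is the pair of opposite
  arcs \<open>(u, v)\<close> and \<open>(v, u)\<close>, so the out-degree of a vertex is its degree, and
  \<^const>\<open>vwalk_length\<close> counts the edges of a walk given by its list of vertices.
\<close>

definition shortest_path :: "'a pair_pre_digraph \<Rightarrow> 'a list \<Rightarrow> bool" where
  "shortest_path H p \<longleftrightarrow>
     vpath p (with_proj H) \<and>
     (\<forall>q. vpath q (with_proj H) \<and> hd q = hd p \<and> last q = last p
        \<longrightarrow> vwalk_length p \<le> vwalk_length q)"

definition general_position_set :: "'a pair_pre_digraph \<Rightarrow> 'a set \<Rightarrow> bool" where
  "general_position_set H S \<longleftrightarrow>
     S \<subseteq> pverts H \<and> \<not> (\<exists>p. shortest_path H p \<and> card (S \<inter> set p) \<ge> 3)"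

definition gp :: "'a pair_pre_digraph \<Rightarrow> nat" where
  "gp H = Max {card S | S. general_position_set H S}"

definition regular :: "nat \<Rightarrow> 'a pair_pre_digraph \<Rightarrow> bool" where
  "regular d G \<longleftrightarrow> (\<forall>v \<in> pverts G. out_degree (with_proj G) v = d)"

datatype 'a myc_vertex = Orig 'a | Copy 'a | Root

definition mycielskian :: "'a pair_pre_digraph \<Rightarrow> 'a myc_vertex pair_pre_digraph" where
  "mycielskian G =
     \<lparr> pverts = Orig ` pverts G \<union> Copy ` pverts G \<union> {Root},
       parcs = {(Orig u, Orig v) | u v. (u, v) \<in> parcs G}
             \<union> {(Orig u, Copy v) | u v. (u, v) \<in> parcs G}
             \<union> {(Copy u, Orig v) | u v. (u, v) \<in> parcs G}
             \<union> {(Copy v, Root) | v. v \<in> pverts G}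
             \<union> {(Root, Copy v) | v. v \<in> pverts G} \<rparr>"

lemma pair_graph_mycielskian:
  assumes "pair_graph G"
  shows "pair_graph (mycielskian G)"
proof -
  interpret pair_graph G by fact
  have sym: "(v, u) \<in> parcs G" if "(u, v) \<in> parcs G" for u v
    using that arcs_symmetric by blast
  have wf: "u \<in> pverts G \<and> v \<in> pverts G" if "(u, v) \<in> parcs G" for u v
    using that in_arcsD1 in_arcsD2 by blast
  have irr: "(u, u) \<notin> parcs G" for u
    using pair_no_loops by fastforce
  have fin: "finite (pverts (mycielskian G))"
    using pair_finite_verts by (simp add: mycielskian_def)
  have sub: "parcs (mycielskian G) \<subseteq> pverts (mycielskian G) \<times> pverts (mycielskian G)"
    using wf by (auto simp: mycielskian_def)
  show ?thesis
  proof unfold_locales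
    show "finite (parcs (mycielskian G))"
      using finite_subset[OF sub] fin by blast
    show "symmetric (with_proj (mycielskian G))"
      unfolding symmetric_def by (auto simp: mycielskian_def sym_def intro: sym)
    show "fst e \<noteq> snd e" if "e \<in> parcs (mycielskian G)" for e
      using that irr by (auto simp: mycielskian_def)
  qed (use sub fin in auto)
qed

lemma gp_attained:
  assumes "pair_graph H"
  shows "\<exists>S. general_position_set H S \<and> card S = gp H"
    and "general_position_set H S \<Longrightarrow> card S \<le> gp H"
proof -
  interpret pair_graph H by fact
  have "{card S | S. general_position_set H S} \<subseteq> card ` Pow (pverts H)"
    by (auto simp: general_position_set_def)
  then have fin: "finite {card S | S. general_position_set H S}"
    using pair_finite_verts finite_subset by blast
  have "general_position_set H {}"
    by (simp add: general_position_set_def)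
  then have "{card S | S. general_position_set H S} \<noteq> {}"
    by blast
  from Max_in[OF fin this] show "\<exists>S. general_position_set H S \<and> card S = gp H"
    by (auto simp: gp_def)
  show "card S \<le> gp H" if "general_position_set H S"
    unfolding gp_def using that by (intro Max_ge[OF fin]) blast
qed

end

theory Submission
  imports Defs
begin

text \<open>
  Let \<open>S\<close> be a general position set of the Mycielskian, and let \<open>A\<close> and \<open>B\<close> be the sets of
  vertices of \<open>G\<close> whose original, respectively whose copy, lies in \<open>S\<close>. If the root is in \<open>S\<close>,
  it lies between any two copies, so that \<open>B\<close> has at most one element \<open>u\<close>. The copy of \<open>u\<close> lies
  between the root and the neighbours of \<open>u\<close>, so such a \<open>u\<close> costs at least one original, and
  \<open>S\<close> has at most \<open>n + 1\<close> elements (\<open>card_S_le_if_root\<close>).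

  If the root is not in \<open>S\<close>, then \<open>card S = n + card X - card Z\<close>, where \<open>X = A \<inter> B\<close> is the set
  of vertices counted twice and \<open>Z\<close> the set of vertices not counted at all. No neighbour of
  \<open>x \<in> X\<close> is in \<open>A\<close>, and at most one is in \<open>B\<close>, because \<open>x\<close> lies between its own copy and its
  neighbours' originals and between the copies of any two neighbours. Let \<open>K\<close> be the set of
  those \<open>x \<in> X\<close> that do have a neighbour in \<open>B\<close>. Every other element of \<open>X\<close> has all of its \<open>d\<close>
  neighbours in \<open>Z\<close>, and the elements of \<open>K\<close> have \<open>d - 1\<close> there. Counting the edges between
  \<open>X\<close> and \<open>Z\<close> from both sides gives \<open>d * card X - card K \<le> d * card Z\<close> (\<open>double_excess\<close>).

  It remains to see that \<open>card K \<le> d * (d - 1) / 2 + 1\<close> (\<open>card_K_le\<close>). Fix \<open>x \<in> K\<close>. For each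
  other \<open>y \<in> K\<close>, with its neighbour \<open>b y \<in> B\<close>, both \<open>y\<close> and \<open>b y\<close> can be reached from \<open>x\<close> by
  a walk with two edges: if \<open>x\<close> and \<open>y\<close> had no common neighbour, the detour through the root
  would be a shortest path with three vertices in \<open>S\<close> (\<open>common_nbr_via_root\<close>), and if \<open>x\<close> and
  \<open>b y\<close> had none, a shortest path from \<open>x\<close> to the copy of \<open>b y\<close> would pass through \<open>y\<close>
  (\<open>common_nbr_via_vertex\<close>). These vertices \<open>y\<close> and \<open>b y\<close> are all distinct, which makes
  \<open>2 * (card K - 1)\<close> of them, while only \<open>d * (d - 1)\<close> walks with two edges start at \<open>x\<close> and
  do not return to it.
\<close>

section \<open>Shortest paths with two and three edges\<close>

lemma shortest_path_two_edges:
  assumes "pair_graph H" and arcs: "(a, m) \<in> parcs H" "(m, c) \<in> parcs H"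
    and "a \<noteq> c" "(a, c) \<notin> parcs H"
  shows "shortest_path H [a, m, c]"
proof -
  interpret pair_graph H by fact
  have "vpath [a, m, c] (with_proj H)"
    using arcs \<open>a \<noteq> c\<close> no_loops' in_arcsD1 in_arcsD2
    by (auto simp: vpath_def vwalk_def)
  moreover have "length q \<ge> 3"
    if "vpath q (with_proj H)" "hd q = a" "last q = c" for q
    using that assms(4,5)
    by (cases q rule: vwalk_arcs.cases) (auto simp: vpath_def vwalk_def Suc_le_eq split: if_splits)
  ultimately show ?thesis
    by (force simp: shortest_path_def)
qed

lemma shortest_path_three_edges:
  assumes "pair_graph H" and arcs: "(a, m) \<in> parcs H" "(m, m') \<in> parcs H" "(m', c) \<in> parcs H"
    and "a \<noteq> c" "(a, c) \<notin> parcs H" and far: "\<And>w. (a, w) \<in> parcs H \<Longrightarrow> (w, c) \<notin> parcs H"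
  shows "shortest_path H [a, m, m', c]"
proof -
  interpret pair_graph H by fact
  have "a \<noteq> m'" "m \<noteq> c"
    using arcs assms(6) by auto
  then have "vpath [a, m, m', c] (with_proj H)"
    using arcs \<open>a \<noteq> c\<close> no_loops' in_arcsD1 in_arcsD2
    by (auto simp: vpath_def vwalk_def)
  moreover have "length q \<ge> 4"
    if q: "vpath q (with_proj H)" "hd q = a" "last q = c" for q
  proof (rule ccontr)
    assume "\<not> length q \<ge> 4"
    then have "length q = 0 \<or> length q = 1 \<or> length q = 2 \<or> length q = 3"
      by linarith
    then show False
      using q assms(5,6) far
      by (auto simp: vpath_def vwalk_def length_Suc_conv numeral_2_eq_2 numeral_3_eq_3)
  qed
  ultimately show ?thesis
    by (force simp: shortest_path_def)
qed

lemma general_position_set_triple: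
  assumes "general_position_set H S" "shortest_path H p" "{x, y, z} \<subseteq> S \<inter> set p"
  shows "x = y \<or> x = z \<or> y = z"
proof (rule ccontr)
  assume "\<not> ?thesis"
  then have "card {x, y, z} = 3"
    by simp
  then have "card (S \<inter> set p) \<ge> 3"
    by (metis assms(3) card_mono finite_Int finite_set)
  with assms show False
    by (auto simp: general_position_set_def)
qed

lemma mycielskian_arcs [simp]:
  "(Orig u, Orig v) \<in> parcs (mycielskian G) \<longleftrightarrow> (u, v) \<in> parcs G"
  "(Orig u, Copy v) \<in> parcs (mycielskian G) \<longleftrightarrow> (u, v) \<in> parcs G"
  "(Copy u, Orig v) \<in> parcs (mycielskian G) \<longleftrightarrow> (u, v) \<in> parcs G"
  "(Copy u, Copy v) \<notin> parcs (mycielskian G)"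
  "(Copy u, Root) \<in> parcs (mycielskian G) \<longleftrightarrow> u \<in> pverts G"
  "(Root, Copy u) \<in> parcs (mycielskian G) \<longleftrightarrow> u \<in> pverts G"
  "(Orig u, Root) \<notin> parcs (mycielskian G)"
  "(Root, Orig u) \<notin> parcs (mycielskian G)"
  by (auto simp: mycielskian_def)

section \<open>General position sets of a Mycielskian\<close>

locale mycielskian_general_position = pair_graph G for G :: "'a pair_pre_digraph" +
  fixes S :: "'a myc_vertex set"
  assumes general_position: "general_position_set (mycielskian G) S"
begin

definition A where "A = {u. Orig u \<in> S}"
definition B where "B = {u. Copy u \<in> S}"

lemma arc_sym: "(u, v) \<in> parcs G \<Longrightarrow> (v, u) \<in> parcs G"
  using arcs_symmetric by blast

lemma A_verts: "A \<subseteq> pverts G" and B_verts: "B \<subseteq> pverts G"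
  using general_position by (auto simp: A_def B_def general_position_set_def mycielskian_def)

lemma finite_A: "finite A" and finite_B: "finite B"
  using A_verts B_verts pair_finite_verts finite_subset by blast+

lemmas shortest_2 = shortest_path_two_edges[OF pair_graph_mycielskian[OF pair_graph_axioms]]
lemmas shortest_3 = shortest_path_three_edges[OF pair_graph_mycielskian[OF pair_graph_axioms]]
lemmas triple = general_position_set_triple[OF general_position]

text \<open>
  The next five lemmas each exhibit a shortest path with two edges, all of whose vertices would
  be in the general position set.
\<close>

lemma at_most_one_copy_with_root:
  assumes "Root \<in> S" "u \<in> B" "v \<in> B"
  shows "u = v"
proof (rule ccontr)
  assume "u \<noteq> v"
  then have "shortest_path (mycielskian G) [Copy u, Root, Copy v]"
    using assms B_verts by (intro shortest_2) auto
  from triple[OF this, of "Copy u" Root "Copy v"] show False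
    using assms \<open>u \<noteq> v\<close> by (auto simp: B_def)
qed

lemma nbr_of_copy_with_root:
  assumes "Root \<in> S" "u \<in> B" "(u, w) \<in> parcs G"
  shows "w \<notin> A"
proof
  assume "w \<in> A"
  have "shortest_path (mycielskian G) [Root, Copy u, Orig w]"
    using assms B_verts by (intro shortest_2) auto
  from triple[OF this, of Root "Copy u" "Orig w"] show False
    using assms \<open>w \<in> A\<close> by (auto simp: A_def B_def)
qed

lemma nbr_of_double:
  assumes "u \<in> A \<inter> B" "(u, w) \<in> parcs G"
  shows "w \<notin> A"
proof
  assume "w \<in> A"
  have "shortest_path (mycielskian G) [Orig u, Orig w, Copy u]"
    using assms arc_sym no_loops' by (intro shortest_2) auto
  from triple[OF this, of "Orig u" "Orig w" "Copy u"] show False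
    using assms \<open>w \<in> A\<close> no_loops' by (auto simp: A_def B_def)
qed

lemma copies_of_nbrs_eq:
  assumes "u \<in> A" "(u, v) \<in> parcs G" "(u, w) \<in> parcs G" "v \<in> B" "w \<in> B"
  shows "v = w"
proof (rule ccontr)
  assume "v \<noteq> w"
  then have "shortest_path (mycielskian G) [Copy v, Orig u, Copy w]"
    using assms arc_sym by (intro shortest_2) auto
  from triple[OF this, of "Copy v" "Orig u" "Copy w"] show False
    using assms \<open>v \<noteq> w\<close> by (auto simp: A_def B_def)
qed

lemma nbrs_of_copy_adjacent:
  assumes "b \<in> B" "(b, x) \<in> parcs G" "(b, y) \<in> parcs G" "x \<in> A" "y \<in> A" "x \<noteq> y"
  shows "(x, y) \<in> parcs G"
proof (rule ccontr)
  assume "(x, y) \<notin> parcs G"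
  then have "shortest_path (mycielskian G) [Orig x, Copy b, Orig y]"
    using assms arc_sym by (intro shortest_2) auto
  from triple[OF this, of "Orig x" "Copy b" "Orig y"] show False
    using assms by (auto simp: A_def B_def)
qed

text \<open>
  Otherwise \<open>x\<close> and the copy of \<open>y\<close> are at distance three, and going from \<open>x\<close> through the copy
  of \<open>b\<close> and the root is a shortest path between them.
\<close>

lemma common_nbr_via_root:
  assumes "x \<in> A" "y \<in> B" "b \<in> B" "(x, b) \<in> parcs G" "(x, y) \<notin> parcs G"
  shows "\<exists>w. (x, w) \<in> parcs G \<and> (w, y) \<in> parcs G"
proof (rule ccontr)
  assume "\<nexists>w. (x, w) \<in> parcs G \<and> (w, y) \<in> parcs G"
  then have "(w, Copy y) \<notin> parcs (mycielskian G)" if "(Orig x, w) \<in> parcs (mycielskian G)" for w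
    using that by (cases w) auto
  then have "shortest_path (mycielskian G) [Orig x, Copy b, Root, Copy y]"
    using assms B_verts by (intro shortest_3) auto
  from triple[OF this, of "Orig x" "Copy b" "Copy y"] show False
    using assms by (auto simp: A_def B_def)
qed

text \<open>
  Otherwise \<open>x\<close> and the copy of \<open>b\<close> are at distance three, with a shortest path through \<open>z\<close>
  and \<open>y\<close>.
\<close>

lemma common_nbr_via_vertex:
  assumes "x \<in> A" "y \<in> A" "b \<in> B" "x \<noteq> y" "(x, b) \<notin> parcs G"
    and "(x, z) \<in> parcs G" "(z, y) \<in> parcs G" "(y, b) \<in> parcs G"
  shows "\<exists>w. (x, w) \<in> parcs G \<and> (w, b) \<in> parcs G"
proof (rule ccontr)
  assume "\<nexists>w. (x, w) \<in> parcs G \<and> (w, b) \<in> parcs G"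
  then have "(w, Copy b) \<notin> parcs (mycielskian G)" if "(Orig x, w) \<in> parcs (mycielskian G)" for w
    using that by (cases w) auto
  then have "shortest_path (mycielskian G) [Orig x, Orig z, Orig y, Copy b]"
    using assms by (intro shortest_3) auto
  from triple[OF this, of "Orig x" "Orig y" "Copy b"] show False
    using assms by (auto simp: A_def B_def)
qed

lemma card_S: "card S = card A + card B + (if Root \<in> S then 1 else 0)"
proof -
  have S: "S = (Orig ` A \<union> Copy ` B) \<union> (if Root \<in> S then {Root} else {})"
  proof (intro set_eqI)
    show "v \<in> S \<longleftrightarrow> v \<in> (Orig ` A \<union> Copy ` B) \<union> (if Root \<in> S then {Root} else {})" for v
      by (cases v) (auto simp: A_def B_def)
  qed
  have "card (Orig ` A \<union> Copy ` B) = card A + card B"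
    using finite_A finite_B by (subst card_Un_disjoint) (auto simp: card_image inj_on_def)
  then show ?thesis
    using finite_A finite_B by (subst S, subst card_Un_disjoint) auto
qed

end

section \<open>Counting in a regular graph\<close>

locale regular_mycielskian_general_position = mycielskian_general_position +
  fixes d :: nat
  assumes regular: "regular d G"
begin

definition nbrs where "nbrs u = {v. (u, v) \<in> parcs G}"

lemma nbrs_verts: "nbrs u \<subseteq> pverts G"
  using in_arcsD2 by (auto simp: nbrs_def)

lemma finite_nbrs: "finite (nbrs u)"
  using nbrs_verts pair_finite_verts finite_subset by blast

lemma card_nbrs: "u \<in> pverts G \<Longrightarrow> card (nbrs u) = d"
proof -
  assume "u \<in> pverts G"
  then have "card (out_arcs (with_proj G) u) = d"
    using regular by (simp add: regular_def out_degree_def)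
  moreover have "out_arcs (with_proj G) u = Pair u ` nbrs u"
    by (auto simp: out_arcs_def nbrs_def)
  ultimately show ?thesis
    by (simp add: card_image inj_on_def)
qed

lemma card_two_steps_le:
  assumes "x \<in> pverts G"
  shows "card {w. w \<noteq> x \<and> (\<exists>m. (x, m) \<in> parcs G \<and> (m, w) \<in> parcs G)} \<le> d * (d - 1)"
proof -
  have "{w. w \<noteq> x \<and> (\<exists>m. (x, m) \<in> parcs G \<and> (m, w) \<in> parcs G)} = (\<Union>m\<in>nbrs x. nbrs m - {x})"
    by (auto simp: nbrs_def)
  moreover have "card (\<Union>m\<in>nbrs x. nbrs m - {x}) \<le> (\<Sum>m\<in>nbrs x. card (nbrs m - {x}))"
    by (rule card_UN_le) (rule finite_nbrs)
  moreover have "card (nbrs m - {x}) = d - 1" if "m \<in> nbrs x" for m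
    using that arc_sym nbrs_verts by (subst card_Diff_singleton)
      (auto simp: nbrs_def card_nbrs[unfolded nbrs_def] dest: in_arcsD2)
  ultimately show ?thesis
    using assms by (simp add: card_nbrs)
qed

text \<open>
  If a copy is in \<open>S\<close> together with the root, some original outside \<open>S\<close> makes up for it; such
  an original exists because the degree is positive.
\<close>

lemma card_S_le_if_root:
  assumes "Root \<in> S" "d \<ge> 1"
  shows "card S \<le> card (pverts G) + 1"
proof (cases "B = {}")
  case True
  then show ?thesis
    using assms card_mono[OF pair_finite_verts A_verts] by (simp add: card_S)
next
  case False
  then obtain u where u: "u \<in> B"
    by blast
  then have B: "B = {u}"
    using assms at_most_one_copy_with_root by blast
  have "nbrs u \<noteq> {}"
    using u B_verts card_nbrs[of u] assms by auto
  then obtain w where "(u, w) \<in> parcs G"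
    by (auto simp: nbrs_def)
  then have "w \<in> pverts G - A"
    using nbr_of_copy_with_root[OF assms(1) u] in_arcsD2 by blast
  then have "A \<subset> pverts G"
    using A_verts by blast
  then have "card A < card (pverts G)"
    using pair_finite_verts psubset_card_mono by blast
  then show ?thesis
    using assms by (simp add: card_S B)
qed

text \<open>
  The vertices counted twice for which one neighbour, instead of lying outside \<open>A \<union> B\<close>, still
  contributes its copy. Only through them can the doubles outnumber the vertices not counted.
\<close>

definition K where "K = {x \<in> A \<inter> B. nbrs x \<inter> B \<noteq> {}}"

text \<open>
  Seen from \<open>x \<in> K\<close>, every other \<open>y \<in> K\<close> uses up two of the at most \<open>d * (d - 1)\<close> vertices
  reached by two edges: itself and its neighbour in \<open>B\<close>. Counting both is what yields the
  factor \<open>1 / 2\<close> in the final bound.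
\<close>

lemma card_K_le: "2 * card K \<le> d * (d - 1) + 2"
proof (cases "K = {}")
  case False
  then obtain x where x: "x \<in> K"
    by blast
  have "\<forall>y\<in>K. \<exists>b. b \<in> B \<and> (y, b) \<in> parcs G"
    by (auto simp: K_def nbrs_def)
  then obtain b where b: "\<And>y. y \<in> K \<Longrightarrow> b y \<in> B" "\<And>y. y \<in> K \<Longrightarrow> (y, b y) \<in> parcs G"
    by metis
  have K: "y \<in> A" "y \<in> B" if "y \<in> K" for y
    using that by (auto simp: K_def)
  have indep: "(y, z) \<notin> parcs G" if "y \<in> K" "z \<in> K" for y z
    using nbr_of_double[of y z] that K by blast
  \<comment> \<open>Two vertices of \<open>K\<close> at the same \<open>b y\<close> would be adjacent, the copy of \<open>b y\<close> being in \<open>S\<close>.\<close>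
  have attached_unique: "y = z" if "y \<in> K" "z \<in> K" "(z, b y) \<in> parcs G" for y z
    using nbrs_of_copy_adjacent[of "b y" y z] that K b indep arc_sym by blast
  define T where "T = {w. w \<noteq> x \<and> (\<exists>m. (x, m) \<in> parcs G \<and> (m, w) \<in> parcs G)}"
  have finite_T: "finite T"
    by (rule finite_subset[OF _ pair_finite_verts]) (auto simp: T_def dest: in_arcsD2)
  have finite_K: "finite K"
    using finite_A by (simp add: K_def)
  have in_T: "y \<in> T \<and> b y \<in> T" if y: "y \<in> K - {x}" for y
  proof -
    have nonadj: "(x, b y) \<notin> parcs G"
      using attached_unique[of y x] x y by blast
    obtain z where z: "(x, z) \<in> parcs G" "(z, y) \<in> parcs G"
      using common_nbr_via_root[of x y "b x"] x y K b indep by blast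
    moreover obtain w where "(x, w) \<in> parcs G" "(w, b y) \<in> parcs G"
      using common_nbr_via_vertex[of x y "b y" z] x y z K b nonadj by blast
    moreover have "b y \<noteq> x"
      using indep[of y x] x y b(2)[of y] by auto
    ultimately show ?thesis
      using y by (auto simp: T_def)
  qed
  have "inj_on b (K - {x})"
    using attached_unique b by (metis DiffD1 inj_onI)
  moreover have "(K - {x}) \<inter> b ` (K - {x}) = {}"
    using indep b by fastforce
  ultimately have "card ((K - {x}) \<union> b ` (K - {x})) = 2 * card (K - {x})"
    using finite_K by (subst card_Un_disjoint) (auto simp: card_image)
  also have "card (K - {x}) = card K - 1"
    using x by simp
  finally have "2 * (card K - 1) \<le> card T"
    using card_mono[OF finite_T, of "(K - {x}) \<union> b ` (K - {x})"] in_T by auto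
  also have "\<dots> \<le> d * (d - 1)"
    unfolding T_def using card_two_steps_le x K A_verts by blast
  finally show ?thesis
    by linarith
qed simp

text \<open>
  This is the double count of the edges between \<open>A \<inter> B\<close> and the complement of \<open>A \<union> B\<close>. A vertex of
  \<open>A \<inter> B\<close> sends \<open>d\<close> edges there, or \<open>d - 1\<close> if it is in \<open>K\<close>; a vertex of the complement
  receives at most \<open>d\<close>.
\<close>

lemma double_excess:
  "d * card (A \<inter> B) \<le> d * card (pverts G - (A \<union> B)) + card K"
proof -
  define X Z where "X = A \<inter> B" and "Z = pverts G - (A \<union> B)"
  have fin: "finite X" "finite Z" "K \<subseteq> X"
    using finite_A pair_finite_verts by (auto simp: X_def Z_def K_def)
  have deg: "d \<le> card (nbrs x \<inter> Z) + (if x \<in> K then 1 else 0)" if x: "x \<in> X" for x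
  proof -
    have "nbrs x = (nbrs x \<inter> Z) \<union> (nbrs x \<inter> B)"
      using nbr_of_double[of x] nbrs_verts[of x] x by (auto simp: X_def Z_def nbrs_def)
    then have "d \<le> card (nbrs x \<inter> Z) + card (nbrs x \<inter> B)"
      using card_nbrs[of x] card_Un_le[of "nbrs x \<inter> Z" "nbrs x \<inter> B"] x A_verts
      by (auto simp: X_def)
    moreover have "card (nbrs x \<inter> B) \<le> (if x \<in> K then 1 else 0)"
    proof (cases "x \<in> K")
      case True
      have "card (nbrs x \<inter> B) \<le> 1"
        using copies_of_nbrs_eq[of x] x finite_nbrs
        by (subst card_le_Suc0_iff_eq[folded One_nat_def]) (auto simp: X_def nbrs_def)
      then show ?thesis using True by simp
    next
      case False
      then have "nbrs x \<inter> B = {}" using x by (auto simp: K_def X_def)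
      then show ?thesis by simp
    qed
    ultimately show ?thesis by linarith
  qed
  have "d * card X \<le> (\<Sum>x\<in>X. card (nbrs x \<inter> Z) + (if x \<in> K then 1 else 0))"
    using sum_mono[OF deg] by (simp add: mult.commute)
  also have "\<dots> = (\<Sum>x\<in>X. card (nbrs x \<inter> Z)) + card K"
    using fin by (simp add: sum.distrib sum.If_cases Int_absorb1)
  also have "(\<Sum>x\<in>X. card (nbrs x \<inter> Z)) = (\<Sum>z\<in>Z. card (nbrs z \<inter> X))"
  proof -
    have "nbrs x \<inter> Z = {z \<in> Z. (x, z) \<in> parcs G}" for x
      by (auto simp: nbrs_def)
    moreover have "nbrs z \<inter> X = {x \<in> X. (x, z) \<in> parcs G}" for z
      using arc_sym by (auto simp: nbrs_def)
    ultimately show ?thesis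
      using fin sum_multicount_gen[of X Z "\<lambda>x z. (x, z) \<in> parcs G"] by simp
  qed
  also have "\<dots> \<le> (\<Sum>z\<in>Z. d)"
    using card_nbrs finite_nbrs
    by (intro sum_mono) (metis DiffD1 Int_lower1 Z_def card_mono)
  finally show ?thesis
    by (simp add: X_def Z_def mult.commute)
qed

lemma card_S_le_if_no_root:
  assumes "Root \<notin> S"
  shows "2 * d * card S \<le> 2 * d * card (pverts G) + d * (d - 1) + 2"
proof -
  have "card (A \<union> B) + card (A \<inter> B) = card S"
    using assms card_Un_Int[OF finite_A finite_B] by (simp add: card_S)
  moreover have "card (pverts G - (A \<union> B)) + card (A \<union> B) = card (pverts G)"
    using A_verts B_verts pair_finite_verts
    by (metis Un_least card_Diff_subset card_mono finite_A finite_B finite_UnI le_add_diff_inverse2)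
  ultimately have "card S + card (pverts G - (A \<union> B)) = card (pverts G) + card (A \<inter> B)"
    by linarith
  then have "2 * d * card S + 2 * (d * card (pverts G - (A \<union> B)))
      = 2 * d * card (pverts G) + 2 * (d * card (A \<inter> B))"
    by (metis add_mult_distrib2 mult.assoc)
  then show ?thesis
    using double_excess card_K_le by linarith
qed

end

lemma connected_regular_degree_pos:
  assumes "pair_graph G" "connected (with_proj G)" "regular d G" "card (pverts G) \<ge> 2"
  shows "d \<ge> 1"
proof -
  interpret pair_graph G by fact
  obtain u v where uv: "u \<in> pverts G" "v \<in> pverts G" "u \<noteq> v"
    using assms(4) pair_finite_verts card_le_Suc0_iff_eq[of "pverts G"] by force
  then have "u \<rightarrow>\<^sup>*\<^bsub>with_proj (mk_symmetric (with_proj G))\<^esub> v"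
    using assms(2) by (auto simp: connected_def strongly_connected_def)
  then obtain w where "(u, w) \<in> parcs (mk_symmetric (with_proj G))"
    using uv(3) by (auto simp: reachable_def elim: converse_rtrancl_on_cases)
  then have "(u, w) \<in> parcs G"
    using arcs_symmetric by (auto simp: mk_symmetric_def)
  then have "(u, w) \<in> out_arcs (with_proj G) u"
    by (simp add: out_arcs_def)
  then have "card (out_arcs (with_proj G) u) > 0"
    using finite_out_arcs card_gt_0_iff by blast
  then show ?thesis
    using assms(3) uv(1) by (auto simp: regular_def out_degree_def)
qed

theorem theorem21:
  fixes G :: "'a pair_pre_digraph" and d n :: nat
  assumes "pair_graph G"
    and "connected (with_proj G)"
    and "regular d G"
    and "card (pverts G) = n"
    and "n \<ge> 3"
  shows "int (gp (mycielskian G)) \<le> int n + \<lfloor>(real d - 1) / 2 + 1 / real d\<rfloor>"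
proof -
  have d: "d \<ge> 1"
    using assms connected_regular_degree_pos by fastforce
  obtain S where S: "general_position_set (mycielskian G) S" "card S = gp (mycielskian G)"
    using gp_attained(1)[OF pair_graph_mycielskian[OF assms(1)]] by blast
  interpret pair_graph G by fact
  interpret regular_mycielskian_general_position G S d
    by unfold_locales (fact S assms)+
  have "2 * d * card S \<le> 2 * d * n + d * (d - 1) + 2"
  proof (cases "Root \<in> S")
    case True
    \<comment> \<open>The excess \<open>1\<close> is within the bound because \<open>(d - 1) (d - 2) \<ge> 0\<close>.\<close>
    have "2 * d \<le> d * (d - 1) + 2"
    proof (cases "d = 1")
      case False
      then have "d * (d - 1) \<ge> 2 * (d - 1)"
        using d by (intro mult_right_mono) auto
      then show ?thesis using d by linarith
    qed simp
    moreover have "2 * d * card S \<le> 2 * d * (n + 1)"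
      using card_S_le_if_root[OF True d] assms(4) by (intro mult_left_mono) auto
    ultimately show ?thesis
      by simp
  qed (use card_S_le_if_no_root assms(4) in simp)
  then have "real (2 * d * card S) \<le> real (2 * d * n + d * (d - 1) + 2)"
    by (simp only: of_nat_le_iff)
  then have "2 * real d * real (card S) \<le> 2 * real d * real n + real d * (real d - 1) + 2"
    using d by (simp add: of_nat_diff)
  then have "real (card S) - real n \<le> (real d - 1) / 2 + 1 / real d"
    using d by (simp add: field_simps)
  then have "int (card S) - int n \<le> \<lfloor>(real d - 1) / 2 + 1 / real d\<rfloor>"
    by (simp add: le_floor_iff)
  then show ?thesis
    using S(2) by linarith
qed

end
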